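(* Let $\{\Theta_{kj}\}_{k,j\in[K]}$ be i.i.d. uniform on $[-\pi,\pi)$. For $\mathbf{P}=(P_1,\dots,P_K)\in[0,1]^K$ and $(\boldsymbol{\alpha},\boldsymbol{\gamma})\in[-\pi,\pi)^{2K}$ define $\beta_{kj}=\cos^2(\alpha_j+\Theta_{kj}-\Theta_{jj}-\gamma_k)$ and $$R_{sum}(\mathbf{P},\boldsymbol{\alpha},\boldsymbol{\gamma})=\sum_{k=1}^K \ln\!\left(1+\frac{P_k\beta_{kk}}{\sum_{j\ne k}P_j\beta_{kj}+\frac12}\right).$$ Then no single-symbol phase alignment scheme can achieve a sum-rate better than $O(\ln K)$ with high probability; that is, there exists a constant $C>0$ such that $$\mathbb{P}\left[\max_{\mathbf{P}\in[0,1]^K,\ (\boldsymbol{\alpha},\boldsymbol{\gamma})\in[-\pi,\pi)^{2K}} R_{sum}(\mathbf{P},\boldsymbol{\alpha},\boldsymbol{\gamma})\le C\ln K\right]\to 1 \quad\text{as } K\to\infty.$$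
   Context: Setting: $K$-user phase-fading complex Gaussian interference channel $Y_k[t]=\sum_j e^{i\Theta_{kj}}X_j[t]+Z_k[t]$ with $Z_k[t]\sim\mathcal{CN}(0,1)$ i.i.d. and time-invariant phases $\Theta_{kj}$ i.i.d. uniform on $[-\pi,\pi)$. A single-symbol phase alignment scheme is one in which each transmitter $k$ uses a real Gaussian codebook with average power $P_k\in[0,1]$, sending $X_k[t]=\sqrt{P_k}e^{i(\alpha_k-\Theta_{kk})}U_k[t]$ with $U_k[t]$ real and unit average power (linear precoding confined to a single complex symbol), and each receiver $k$ treats interference as noise after projecting its received signal onto direction $e^{i\gamma_k}$ (i.e., taking $\mathsf{Re}(e^{-i\gamma_k}Y_k[t])$). The resulting rate of user $k$ is $\ln\bigl(1+\frac{P_k\beta_{kk}}{\sum_{j\ne k}P_j\beta_{kj}+1/2}\bigr)$, so the best sum-rate in this class is the maximum of $R_{sum}$ displayed in the claim. The probability is over the phases $\{\Theta_{kj}\}$. *)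

theory Defs
  imports "HOL-Probability.Probability"
begin

text \<open>Users are indexed by {..<K} (0-based). The phases form a function
  Theta :: nat \<times> nat \<Rightarrow> real; Theta (k,j) is the phase from transmitter j to receiver k.\<close>

definition phase_space :: "nat \<Rightarrow> (nat \<times> nat \<Rightarrow> real) measure" where
  "phase_space K = PiM ({..<K} \<times> {..<K}) (\<lambda>_. uniform_measure lborel {-pi..<pi})"

definition beta :: "(nat \<times> nat \<Rightarrow> real) \<Rightarrow> (nat \<Rightarrow> real) \<Rightarrow> (nat \<Rightarrow> real) \<Rightarrow> nat \<Rightarrow> nat \<Rightarrow> real" where
  "beta Theta alpha gamma k j = (cos (alpha j + Theta (k,j) - Theta (j,j) - gamma k))\<^sup>2"

definition Rsum :: "nat \<Rightarrow> (nat \<times> nat \<Rightarrow> real) \<Rightarrow> (nat \<Rightarrow> real) \<Rightarrow> (nat \<Rightarrow> real) \<Rightarrow> (nat \<Rightarrow> real) \<Rightarrow> real" where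
  "Rsum K Theta P alpha gamma =
     (\<Sum>k<K. ln (1 + P k * beta Theta alpha gamma k k /
        ((\<Sum>j\<in>{..<K} - {k}. P j * beta Theta alpha gamma k j) + 1/2)))"

definition feasible :: "nat \<Rightarrow> ((nat \<Rightarrow> real) \<times> (nat \<Rightarrow> real) \<times> (nat \<Rightarrow> real)) set" where
  "feasible K = {(P, alpha, gamma). \<forall>k<K. P k \<in> {0..1} \<and> alpha k \<in> {-pi..<pi} \<and> gamma k \<in> {-pi..<pi}}"

definition max_Rsum :: "nat \<Rightarrow> (nat \<times> nat \<Rightarrow> real) \<Rightarrow> real" where
  "max_Rsum K Theta = (SUP (P, alpha, gamma) \<in> feasible K. Rsum K Theta P alpha gamma)"

end

theory Submission
  imports Defs
begin

text \<open>
  Sort the users by power into dyadic levels \<open>(2\<^sup>-\<^sup>l\<^sup>-\<^sup>1, 2\<^sup>-\<^sup>l]\<close>; users below \<open>1/K\<close> contribute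
  \<open>O(1)\<close> in total, so only \<open>O(ln K)\<close> levels matter. Within a level \<open>A\<close> of \<open>n\<close> users, a user whose
  interference from \<open>A\<close> alone is at least a constant times \<open>n 2\<^sup>-\<^sup>l\<close> has rate \<open>O(1/n)\<close>, so these
  users contribute \<open>O(1)\<close> per level. Every other user of the level contributes at most \<open>2 2\<^sup>-\<^sup>l\<close>,
  which sums geometrically over the levels once each level has only \<open>O(ln K)\<close> such users.

  To see that this last condition holds simultaneously for all sets \<open>A\<close> and all angles, round the
  angles to a grid of constant size. If \<open>r\<close> users of \<open>A\<close> see weak interference, then a sum of
  \<open>r (n - 1)\<close> independent terms \<open>cos\<^sup>2\<close> is a constant factor below its mean, which has probability
  \<open>exp (- \<Omega>(r n))\<close>. With \<open>r\<close> a large multiple of \<open>ln K\<close> this beats the \<open>O(1)\<^sup>n\<close> choices of weak users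
  and grid angles as well as the at most \<open>K\<^sup>n\<close> choices of \<open>A\<close>.
\<close>

section \<open>Regularity and period of the squared cosine\<close>

lemma cos_squared_diff_le: "\<bar>(cos x)\<^sup>2 - (cos y)\<^sup>2\<bar> \<le> \<bar>x - y\<bar>" for x y :: real
proof -
  have "(cos x)\<^sup>2 - (cos y)\<^sup>2 = (cos (2*x) - cos (2*y)) / 2"
    by (simp add: cos_double_cos)
  also have "\<dots> = sin (x + y) * sin (y - x)"
    by (simp add: cos_diff_cos add_divide_distrib diff_divide_distrib algebra_simps)
  also have "\<bar>\<dots>\<bar> \<le> 1 * \<bar>y - x\<bar>"
    unfolding abs_mult by (intro mult_mono abs_sin_le_one abs_sin_x_le_abs_x) auto
  finally show ?thesis by simp
qed

text \<open>Only the doubled angle enters a squared cosine, so the period is \<open>pi\<close>.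
  Angles therefore need rounding only modulo \<open>pi\<close>, which keeps the grid finite.\<close>

lemma cos_squared_plus_int_pi: "(cos (x + of_int m * pi))\<^sup>2 = (cos x)\<^sup>2" for x :: real
proof -
  have "2 * (x + of_int m * pi) = 2 * x + of_int m * (2 * pi)" by (simp add: algebra_simps)
  then have "cos (2 * (x + of_int m * pi)) = cos (2 * x)"
    by (simp only: cos_add mult.commute[of "of_int m"] cos_int_2pin sin_int_2pin)
  then show ?thesis
    using cos_double_cos[of x] cos_double_cos[of "x + of_int m * pi"] by linarith
qed

section \<open>Lower tail of sums of independent squared cosines\<close>

abbreviation uniform_phase :: "real measure" where
  "uniform_phase \<equiv> uniform_measure lborel {-pi..<pi}"

lemma prob_space_uniform_phase: "prob_space uniform_phase"
  by (rule prob_space_uniform_measure) auto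

lemma integral_cos_squared_uniform_phase:
  "(\<integral>x. (cos (c + x))\<^sup>2 \<partial>uniform_phase) = 1/2"
proof -
  define F where "F x = x/2 + sin (2 * (c + x)) / 4" for x
  have "has_bochner_integral lborel (\<lambda>x. (cos (c + x))\<^sup>2 * indicator {-pi..pi} x) (F pi - F (-pi))"
  proof (rule has_bochner_integral_FTC_Icc_real)
    fix x :: real assume "-pi \<le> x" "x \<le> pi"
    have "DERIV F x :> 1/2 + cos (2 * (c + x)) / 2"
      unfolding F_def by (auto intro!: derivative_eq_intros)
    also have "1/2 + cos (2 * (c + x)) / 2 = (cos (c + x))\<^sup>2"
      unfolding cos_double_cos by (simp add: diff_divide_distrib)
    finally show "DERIV F x :> (cos (c + x))\<^sup>2" .
  qed auto
  moreover have "sin (2 * (c + pi)) = sin (2 * (c - pi))"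
    using sin_periodic[of "2 * c"] sin_periodic[of "2 * c - 2 * pi"] by (simp add: algebra_simps)
  hence "F pi - F (-pi) = pi" by (simp add: F_def)
  ultimately have *: "(\<integral>x. (cos (c + x))\<^sup>2 * indicator {-pi..pi} x \<partial>lborel) = pi"
    by (simp add: has_bochner_integral_iff)
  have d: "uniform_phase = density lborel (\<lambda>x. ennreal (indicator {-pi..<pi} x / (2 * pi)))"
    unfolding uniform_measure_def
    by (rule arg_cong[where f="density lborel"])
       (auto simp: fun_eq_iff divide_ennreal ennreal_1[symmetric] simp del: ennreal_1 split: split_indicator)
  have "(\<integral>x. (cos (c + x))\<^sup>2 \<partial>uniform_phase)
      = (\<integral>x. (indicator {-pi..<pi} x / (2 * pi)) *\<^sub>R (cos (c + x))\<^sup>2 \<partial>lborel)"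
    unfolding d by (rule integral_density) auto
  also have "\<dots> = (\<integral>x. (1 / (2 * pi)) * ((cos (c + x))\<^sup>2 * indicator {-pi..pi} x) \<partial>lborel)"
  \<comment> \<open>The fundamental theorem was applied on the closed interval; the half-open one
    differs from it only in the null set \<open>{pi}\<close>.\<close>
  proof (rule integral_cong_AE)
    show "AE x in lborel. (indicator {-pi..<pi} x / (2 * pi)) *\<^sub>R (cos (c + x))\<^sup>2
        = 1 / (2 * pi) * ((cos (c + x))\<^sup>2 * indicator {-pi..pi} x)"
      using AE_lborel_singleton[of pi] by eventually_elim (auto split: split_indicator)
  qed auto
  also have "\<dots> = 1/2"
    unfolding * integral_mult_right_zero by simp
  finally show ?thesis .
qed

text \<open>Convexity puts \<open>exp\<close> below its chord over [-1, 0], and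
  \<open>exp (-1) \<le> 1/2\<close> bounds that chord. A linear bound lets the exponential moment be
  estimated from the mean alone.\<close>

lemma exp_minus_le_half:
  fixes x :: real assumes "0 \<le> x" "x \<le> 1" shows "exp (-x) \<le> 1 - x/2"
proof -
  have "exp ((1 - x) *\<^sub>R 0 + x *\<^sub>R (- 1)) \<le> (1 - x) * exp 0 + x * exp (-1 :: real)"
    using assms by (intro convex_onD[OF exp_convex]) auto
  moreover have "exp (-1 :: real) \<le> 1/2"
    using exp_ge_add_one_self[of "1::real"] by (simp add: exp_minus field_simps)
  then have "x * exp (-1) \<le> x * (1/2)" using assms(1) by (rule mult_left_mono)
  ultimately show ?thesis by simp
qed

text \<open>Linearising the exponential and inserting the mean 1/2 gives 1 - 1/4, which is at most
  \<open>exp (-1/4)\<close>.\<close>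

lemma integral_exp_minus_cos_squared_le:
  "(\<integral>x. exp (- (cos (c + x))\<^sup>2) \<partial>uniform_phase) \<le> exp (-1/4)"
proof -
  interpret prob_space uniform_phase by (rule prob_space_uniform_phase)
  have [simp]: "integrable uniform_phase (\<lambda>x. (cos (c + x))\<^sup>2)"
    by (rule integrable_const_bound[where B=1]) (auto simp: abs_square_le_1)
  have "\<bar>1 - (cos y)\<^sup>2 / 2\<bar> \<le> 1" for y :: real
    using abs_square_le_1[of "cos y"] zero_le_power2[of "cos y"] abs_cos_le_one[of y] by linarith
  then have "(\<integral>x. exp (- (cos (c + x))\<^sup>2) \<partial>uniform_phase)
      \<le> (\<integral>x. 1 - (cos (c + x))\<^sup>2 / 2 \<partial>uniform_phase)"
    by (intro integral_mono integrable_const_bound[where B=1])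
       (auto intro!: exp_minus_le_half simp: abs_square_le_1)
  also have "\<dots> = 3/4" by (simp add: integral_cos_squared_uniform_phase prob_space[unfolded space_uniform_measure])
  also have "\<dots> \<le> exp (-1/4 :: real)"
    using exp_ge_add_one_self[of "-1/4::real"] by simp
  finally show ?thesis .
qed
text \<open>Chernoff bound with exponent 1: by independence the moment of \<open>exp (- sum)\<close>
  is at most \<open>exp (- card D / 4)\<close>, and Markov's inequality at a quarter of the mean
  \<open>card D / 2\<close> gives back a factor \<open>exp (card D / 8)\<close>.\<close>

lemma prob_sum_cos_squared_le:
  fixes c :: "'i \<Rightarrow> real" and I D :: "'i set"
  defines "M \<equiv> PiM I (\<lambda>_. uniform_phase)"
  assumes "finite I" "D \<subseteq> I"
  shows "measure M {Theta \<in> space M. (\<Sum>i\<in>D. (cos (c i + Theta i))\<^sup>2) \<le> real (card D) / 8}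
    \<le> exp (- real (card D) / 8)"
proof -
  interpret U: prob_space uniform_phase by (rule prob_space_uniform_phase)
  interpret product_prob_space "\<lambda>_. uniform_phase" I
    by (intro product_prob_spaceI U.prob_space_axioms)
  \<comment> \<open>Coordinates outside \<open>D\<close> get the factor 1, so that the product
    formula over all of \<open>I\<close> applies.\<close>
  define f where "f i x = (if i \<in> D then exp (- (cos (c i + x))\<^sup>2) else 1)" for i x
  define u where "u Theta = (\<Prod>i\<in>I. f i (Theta i))" for Theta
  have u: "u Theta = exp (- (\<Sum>i\<in>D. (cos (c i + Theta i))\<^sup>2))" for Theta
    using assms finite_subset[OF assms(3,2)]
    by (simp add: u_def f_def prod.If_cases Int_absorb1 exp_sum sum_negf[symmetric])
  then have u_nonneg: "0 \<le> u Theta" for Theta by simp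
  have int: "integrable uniform_phase (f i)" for i
    unfolding f_def by (intro U.integrable_const_bound[where B=1]) auto
  have "integrable M u"
    unfolding u_def M_def using assms(2) int by (intro product_integrable_prod) auto
  have "(\<integral>Theta. u Theta \<partial>M) = (\<Prod>i\<in>I. \<integral>x. f i x \<partial>uniform_phase)"
    unfolding u_def M_def using assms(2) int by (intro product_integral_prod) auto
  also have "\<dots> \<le> (\<Prod>i\<in>I. if i \<in> D then exp (-1/4) else 1)"
    by (intro prod_mono)
       (use integral_exp_minus_cos_squared_le in
         \<open>auto simp: f_def U.prob_space[unfolded space_uniform_measure]\<close>)
  also have "\<dots> = exp (- real (card D) / 4)"
    using assms(2,3) by (simp add: prod.If_cases Int_absorb1 exp_of_nat_mult[symmetric])
  finally have E: "(\<integral>Theta. u Theta \<partial>M) \<le> exp (- real (card D) / 4)" .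
  have "measure M {Theta \<in> space M. u Theta \<ge> exp (- real (card D) / 8)}
      \<le> (\<integral>Theta. u Theta \<partial>M) / exp (- real (card D) / 8)"
    using \<open>integrable M u\<close> by (intro integral_Markov_inequality_measure[where A="{}"]) (auto simp: u_nonneg)
  also have "\<dots> \<le> exp (- real (card D) / 4) / exp (- real (card D) / 8)"
    by (intro divide_right_mono E) auto
  also have "\<dots> = exp (- real (card D) / 8)"
    by (simp add: exp_diff[symmetric])
  finally show ?thesis by (simp add: u)
qed

section \<open>Probability of alignment on the grid of angles\<close>

text \<open>The period \<open>pi\<close> splits into 64 cells, and \<open>pi < 4\<close> makes each
  narrower than 1/16, half of the constant 1/8 in \<open>aligned\<close>.\<close>

definition grid :: real where "grid = pi / 64"

text \<open>The angles \<open>p j * grid\<close> stand for \<open>alpha j - Theta (j, j)\<close> and \<open>q k * grid\<close> for \<open>gamma k\<close>, both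
  modulo \<open>pi\<close>. Absorbing \<open>Theta (j, j)\<close> into the free angle leaves only the independent
  off-diagonal phases as randomness.\<close>
definition aligned :: "nat set \<Rightarrow> nat set \<Rightarrow> (nat \<Rightarrow> int) \<Rightarrow> (nat \<Rightarrow> int) \<Rightarrow> (nat \<times> nat \<Rightarrow> real) \<Rightarrow> bool" where
  "aligned A B p q Theta \<longleftrightarrow>
     (\<Sum>k\<in>B. \<Sum>j\<in>A - {k}. (cos (p j * grid + Theta (k, j) - q k * grid))\<^sup>2)
       \<le> real (card B) * (real (card A) - 1) / 8"

definition many_aligned :: "real \<Rightarrow> nat set \<Rightarrow> (nat \<times> nat \<Rightarrow> real) \<Rightarrow> bool" where
  "many_aligned R A Theta \<longleftrightarrow>
     (\<exists>B\<in>{B \<in> Pow A. R < card B}. \<exists>p\<in>A \<rightarrow>\<^sub>E {0..<64}. \<exists>q\<in>A \<rightarrow>\<^sub>E {0..<64}. aligned A B p q Theta)"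

lemma prob_space_phase_space: "prob_space (phase_space K)"
  unfolding phase_space_def by (intro prob_space_PiM prob_space_uniform_phase)

lemma measurable_phase [measurable]:
  "k < K \<Longrightarrow> j < K \<Longrightarrow> (\<lambda>Theta. Theta (k, j)) \<in> borel_measurable (phase_space K)"
  unfolding phase_space_def
  using measurable_component_singleton[of "(k, j)" "{..<K} \<times> {..<K}" "\<lambda>_. uniform_phase"]
  by (simp cong: measurable_cong_sets)

lemma measurable_aligned:
  assumes "A \<subseteq> {..<K}" "B \<subseteq> A"
  shows "{Theta \<in> space (phase_space K). aligned A B p q Theta} \<in> sets (phase_space K)"
proof -
  have [measurable]: "(\<lambda>Theta. Theta (k, j)) \<in> borel_measurable (phase_space K)"
    if "k \<in> B" "j \<in> A - {k}" for k j
    using that assms by (intro measurable_phase) auto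
  show ?thesis unfolding aligned_def by measurable
qed

lemma prob_aligned_le:
  fixes R :: real
  assumes "A \<subseteq> {..<K}" "B \<subseteq> A" "R < card B" "1 \<le> R"
  shows "measure (phase_space K) {Theta \<in> space (phase_space K). aligned A B p q Theta}
    \<le> exp (- R / 16) ^ card A"
proof -
  have fin: "finite A" "finite B" using assms(1,2) finite_subset[of A "{..<K}"] finite_subset[of B A] by auto
  define D where "D = (SIGMA k:B. A - {k})"
  define c where "c = (\<lambda>(k, j). p j * grid - q k * grid)"
  have cB: "1 < card B" "card B \<le> card A" using assms(3,4) card_mono[OF fin(1) assms(2)] by auto
  have "card D = (\<Sum>k\<in>B. card (A - {k}))"
    unfolding D_def using fin by (intro card_SigmaI) auto
  also have "\<dots> = (\<Sum>k\<in>B. card A - 1)"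
    using assms(2) by (intro sum.cong) (auto simp: card_Diff_singleton)
  finally have card: "real (card D) = real (card B) * (real (card A) - 1)"
    using cB by (simp add: of_nat_diff)
  \<comment> \<open>Since \<open>card B > R \<ge> 1\<close>, the set \<open>A\<close> has at least
    two elements, so \<open>card A - 1\<close> is at least \<open>card A / 2\<close>. This makes the
    exponent a multiple of \<open>R * card A\<close>.\<close>
  have le: "R * (real (card A) / 2) \<le> real (card D)"
    unfolding card using assms(3,4) cB by (intro mult_mono) auto
  have "(\<Sum>k\<in>B. \<Sum>j\<in>A - {k}. (cos (p j * grid + Theta (k, j) - q k * grid))\<^sup>2)
      = (\<Sum>i\<in>D. (cos (c i + Theta i))\<^sup>2)" for Theta
    unfolding D_def c_def using fin by (subst sum.Sigma) (auto intro!: sum.cong simp: algebra_simps)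
  then have "measure (phase_space K) {Theta \<in> space (phase_space K). aligned A B p q Theta}
    = measure (phase_space K) {Theta \<in> space (phase_space K). (\<Sum>i\<in>D. (cos (c i + Theta i))\<^sup>2) \<le> real (card D) / 8}"
    unfolding aligned_def card by simp
  also have "\<dots> \<le> exp (- real (card D) / 8)"
    unfolding phase_space_def using assms(1,2) by (intro prob_sum_cos_squared_le) (auto simp: D_def)
  also have "\<dots> \<le> exp (real (card A) * (- R / 16))"
    using le by (simp add: mult.commute)
  also have "\<dots> = exp (- R / 16) ^ card A" by (rule exp_of_nat_mult)
  finally show ?thesis .
qed

lemma measurable_many_aligned:
  assumes "A \<subseteq> {..<K}"
  shows "{Theta \<in> space (phase_space K). many_aligned R A Theta} \<in> sets (phase_space K)"
proof -
  have fin: "finite A" using assms finite_subset by blast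
  show ?thesis unfolding many_aligned_def
    by (intro sets.sets_Collect_finite_Ex measurable_aligned) (use fin assms in \<open>auto intro: finite_PiE\<close>)
qed

text \<open>Union bound: there are at most 2^n choices of \<open>B\<close> and 64^n of each of
  \<open>p\<close> and \<open>q\<close>, where n is \<open>card A\<close>, and 2 * 64 * 64 =
  8192.\<close>

lemma prob_many_aligned_le:
  assumes "A \<subseteq> {..<K}" "1 \<le> R"
  shows "measure (phase_space K) {Theta \<in> space (phase_space K). many_aligned R A Theta}
    \<le> (8192 * exp (- R / 16)) ^ card A"
proof -
  interpret prob_space "phase_space K" by (rule prob_space_phase_space)
  have fin: "finite A" using assms(1) finite_subset by blast
  let ?P = "A \<rightarrow>\<^sub>E {0..<64::int}"
  define T where "T = {B \<in> Pow A. R < card B} \<times> ?P \<times> ?P"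
  have finT: "finite T" unfolding T_def using fin by (intro finite_cartesian_product finite_PiE) auto
  have "card T = card {B \<in> Pow A. R < card B} * (64 ^ card A * 64 ^ card A)"
    unfolding T_def using fin by (simp add: card_cartesian_product card_PiE)
  also have "\<dots> \<le> 2 ^ card A * (64 ^ card A * 64 ^ card A)"
    using card_mono[of "Pow A" "{B \<in> Pow A. R < card B}"] fin by (auto simp: card_Pow)
  also have "\<dots> = 8192 ^ card A" by (simp flip: power_mult_distrib)
  finally have cT: "real (card T) \<le> 8192 ^ card A" by (metis of_nat_le_iff of_nat_numeral of_nat_power)
  define F where "F = (\<lambda>(B, p, q). {Theta \<in> space (phase_space K). aligned A B p q Theta})"
  have "{Theta \<in> space (phase_space K). many_aligned R A Theta} = (\<Union>t\<in>T. F t)"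
    unfolding many_aligned_def T_def F_def by auto
  also have "measure (phase_space K) \<dots> \<le> (\<Sum>t\<in>T. measure (phase_space K) (F t))"
    using finT assms(1) by (intro measure_UNION_le) (auto simp: T_def F_def intro!: measurable_aligned)
  also have "\<dots> \<le> (\<Sum>t\<in>T. exp (- R / 16) ^ card A)"
  proof (rule sum_mono)
    fix t assume "t \<in> T"
    then obtain B p q where "t = (B, p, q)" "B \<subseteq> A" "R < card B" by (auto simp: T_def)
    then show "measure (phase_space K) (F t) \<le> exp (- R / 16) ^ card A"
      unfolding F_def using prob_aligned_le[of A K B R p q] assms by simp
  qed
  also have "\<dots> \<le> 8192 ^ card A * exp (- R / 16) ^ card A"
    using cT by (auto intro!: mult_right_mono)
  finally show ?thesis by (simp add: power_mult_distrib)
qed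

lemma sum_power_card_nonempty_subsets:
  assumes "finite S"
  shows "(\<Sum>A\<in>Pow S - {{}}. y ^ card A) = (1 + y) ^ card S - (1 :: real)"
proof -
  have "(1 + y) ^ card S = (\<Sum>A\<in>Pow S. y ^ card A)"
    using prod_add[OF assms, of "\<lambda>_. y" "\<lambda>_. 1"] by (simp add: add.commute)
  then show ?thesis using assms by (simp add: sum_diff1)
qed

text \<open>The factor 32 makes \<open>exp (- R / 16)\<close> equal to K^-2, so each element of
  \<open>A\<close> contributes \<open>y = 8192 / K^2\<close>. Summing over all sets by the binomial
  identity gives \<open>(1 + y) ^ K - 1\<close>, which is small because \<open>K * y\<close> tends
  to 0.\<close>

lemma prob_ex_many_aligned_le:
  assumes "2 \<le> K"
  shows "measure (phase_space K)
      {Theta \<in> space (phase_space K). \<exists>A\<in>Pow {..<K} - {{}}. many_aligned (32 * ln K) A Theta}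
    \<le> exp (8192 / K) - 1"
proof -
  interpret prob_space "phase_space K" by (rule prob_space_phase_space)
  let ?R = "32 * ln (real K)"
  define y where "y = 8192 * exp (- ?R / 16)"
  have "1 - inverse (real K) \<le> ln (real K)"
    using assms ln_le_minus_one[of "inverse (real K)"] by (simp add: ln_inverse)
  moreover have "inverse (real K) \<le> 1/2" using assms by (simp add: field_simps)
  ultimately have R: "1 \<le> ?R" by linarith
  have "exp (- ?R / 16) = exp (- ln (real K)) ^ 2"
    by (simp add: exp_of_nat_mult[symmetric])
  also have "\<dots> = 1 / (real K)\<^sup>2" using assms by (simp add: exp_minus field_simps)
  finally have y: "y = 8192 / (real K)\<^sup>2" by (simp add: y_def)
  have "{Theta \<in> space (phase_space K). \<exists>A\<in>Pow {..<K} - {{}}. many_aligned ?R A Theta}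
      = (\<Union>A\<in>Pow {..<K} - {{}}. {Theta \<in> space (phase_space K). many_aligned ?R A Theta})" by auto
  also have "measure (phase_space K) \<dots> \<le> (\<Sum>A\<in>Pow {..<K} - {{}}.
      measure (phase_space K) {Theta \<in> space (phase_space K). many_aligned ?R A Theta})"
    by (intro measure_UNION_le) (auto intro!: measurable_many_aligned)
  also have "\<dots> \<le> (\<Sum>A\<in>Pow {..<K} - {{}}. y ^ card A)"
    unfolding y_def using R by (intro sum_mono prob_many_aligned_le) auto
  also have "\<dots> = (1 + y) ^ K - 1" by (simp add: sum_power_card_nonempty_subsets)
  also have "\<dots> \<le> exp y ^ K - 1"
    unfolding y by (intro diff_right_mono power_mono) (auto simp: exp_ge_add_one_self)
  also have "exp y ^ K = exp (8192 / K)"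
    unfolding exp_of_nat_mult[symmetric] y using assms by (simp add: power2_eq_square)
  finally show ?thesis .
qed

section \<open>Bounds on the rate of a single user\<close>

lemma beta_bounds: "0 \<le> beta Theta alpha gamma k j" "beta Theta alpha gamma k j \<le> 1"
  by (simp_all add: beta_def abs_square_le_1)

definition rate :: "nat \<Rightarrow> (nat \<times> nat \<Rightarrow> real) \<Rightarrow> (nat \<Rightarrow> real) \<Rightarrow> (nat \<Rightarrow> real) \<Rightarrow> (nat \<Rightarrow> real) \<Rightarrow> nat \<Rightarrow> real" where
  "rate K Theta P alpha gamma k = ln (1 + P k * beta Theta alpha gamma k k /
        ((\<Sum>j\<in>{..<K} - {k}. P j * beta Theta alpha gamma k j) + 1/2))"

lemma Rsum_eq_sum_rate: "Rsum K Theta P alpha gamma = (\<Sum>k<K. rate K Theta P alpha gamma k)"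
  by (simp add: Rsum_def rate_def)

text \<open>Follows from \<open>ln (1 + x) \<le> x\<close> and \<open>beta \<le> 1\<close>. Here
  \<open>d\<close> is any positive lower bound on interference plus noise; the noise alone gives
  \<open>d = 1/2\<close>.\<close>

lemma rate_le_divide:
  assumes "\<And>j. j < K \<Longrightarrow> 0 \<le> P j" "k < K" "0 < d"
    and "d \<le> (\<Sum>j\<in>{..<K} - {k}. P j * beta Theta alpha gamma k j) + 1/2"
  shows "rate K Theta P alpha gamma k \<le> P k / d"
proof -
  let ?I = "(\<Sum>j\<in>{..<K} - {k}. P j * beta Theta alpha gamma k j) + 1/2"
  have nn: "0 \<le> P k * beta Theta alpha gamma k k / ?I"
    using assms by (intro divide_nonneg_nonneg mult_nonneg_nonneg beta_bounds) auto
  then have "rate K Theta P alpha gamma k \<le> P k * beta Theta alpha gamma k k / ?I"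
    unfolding rate_def by (intro ln_add_one_self_le_self) auto
  also have "\<dots> \<le> P k / d"
    using assms beta_bounds[of Theta alpha gamma k k]
    by (intro frac_le mult_left_le) auto
  finally show ?thesis .
qed

lemma interference_nonneg:
  assumes "\<And>j. j < K \<Longrightarrow> 0 \<le> P j"
  shows "0 \<le> (\<Sum>j\<in>{..<K} - {k}. P j * beta Theta alpha gamma k j)"
  using assms by (intro sum_nonneg mult_nonneg_nonneg beta_bounds) auto

lemma rate_le_twice_power:
  assumes "\<And>j. j < K \<Longrightarrow> 0 \<le> P j" "k < K"
  shows "rate K Theta P alpha gamma k \<le> 2 * P k"
  using rate_le_divide[of K P k "1/2" Theta alpha gamma] interference_nonneg[OF assms(1)] assms by simp

section \<open>Finiteness and measurability of the maximal sum-rate\<close>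

lemma Rsum_le:
  assumes "(P, alpha, gamma) \<in> feasible K"
  shows "Rsum K Theta P alpha gamma \<le> 2 * real K"
proof -
  have "rate K Theta P alpha gamma k \<le> 2" if "k < K" for k
    using rate_le_twice_power[of K P k Theta alpha gamma] assms that by (fastforce simp: feasible_def)
  then have "(\<Sum>k<K. rate K Theta P alpha gamma k) \<le> (\<Sum>k<K. 2)" by (intro sum_mono) auto
  then show ?thesis by (simp add: Rsum_eq_sum_rate mult.commute)
qed

text \<open>A real \<open>SUP\<close> compares pointwise with \<open>c\<close> when the range is
  nonempty and bounded above; the zero parameters and the crude bound \<open>2 * K\<close> supply
  this.\<close>

lemma max_Rsum_le_iff:
  "max_Rsum K Theta \<le> c \<longleftrightarrow> (\<forall>(P, alpha, gamma)\<in>feasible K. Rsum K Theta P alpha gamma \<le> c)"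
proof -
  have "(\<lambda>_. 0, \<lambda>_. 0, \<lambda>_. 0) \<in> feasible K" by (simp add: feasible_def)
  then have "feasible K \<noteq> {}" by blast
  moreover have "bdd_above ((\<lambda>(P, alpha, gamma). Rsum K Theta P alpha gamma) ` feasible K)"
    by (rule bdd_aboveI[where M="2 * real K"]) (auto intro: Rsum_le)
  ultimately show ?thesis unfolding max_Rsum_def by (subst cSUP_le_iff) auto
qed

lemma ex_countable_sequentially_dense:
  fixes S :: "real set"
  obtains D where "countable D" "D \<subseteq> S" "\<And>x. x \<in> S \<Longrightarrow> \<exists>f. (\<forall>n. f n \<in> D) \<and> f \<longlonglongrightarrow> x"
proof -
  obtain D where "countable D" "D \<subseteq> S" "S \<subseteq> closure D" by (rule separable)
  then show thesis by (intro that[of D]) (auto simp: closure_sequential)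
qed

text \<open>The supremum ranges over an uncountable set; by continuity in the parameters a countable dense
  subset suffices.\<close>
lemma measurable_max_Rsum_le:
  "{Theta \<in> space (phase_space K). max_Rsum K Theta \<le> c} \<in> sets (phase_space K)"
proof -
  obtain D where D: "countable D" "D \<subseteq> {0..1::real}"
    "\<And>x. x \<in> {0..1} \<Longrightarrow> \<exists>f. (\<forall>n. f n \<in> D) \<and> f \<longlonglongrightarrow> x"
    by (rule ex_countable_sequentially_dense[of "{0..1}"]) blast
  obtain E where E: "countable E" "E \<subseteq> {-pi..<pi}"
    "\<And>x. x \<in> {-pi..<pi} \<Longrightarrow> \<exists>f. (\<forall>n. f n \<in> E) \<and> f \<longlonglongrightarrow> x"
    by (rule ex_countable_sequentially_dense[of "{-pi..<pi}"]) blast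
  \<comment> \<open>Extensional functions on the finite set \<open>{..<K}\<close> keep
    \<open>Q\<close> countable, while \<open>Rsum\<close> reads only coordinates below
    \<open>K\<close>.\<close>
  define Q where "Q = ({..<K} \<rightarrow>\<^sub>E D) \<times> ({..<K} \<rightarrow>\<^sub>E E) \<times> ({..<K} \<rightarrow>\<^sub>E E)"
  have Q: "countable Q" unfolding Q_def using D(1) E(1) by (auto intro!: countable_SIGMA countable_PiE)
  have "Q \<subseteq> feasible K"
    using D(2) E(2) unfolding Q_def feasible_def by (auto simp: PiE_iff subset_iff)
  have lim: "Rsum K Theta P alpha gamma \<le> c"
    if le: "\<forall>(P, alpha, gamma)\<in>Q. Rsum K Theta P alpha gamma \<le> c"
      and f: "(P, alpha, gamma) \<in> feasible K" for Theta P alpha gamma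
  proof -
    from f have "\<forall>k\<in>{..<K}. \<exists>f. (\<forall>n. f n \<in> D) \<and> f \<longlonglongrightarrow> P k"
      by (auto simp: feasible_def intro!: D(3))
    then obtain p where p: "\<And>k n. k < K \<Longrightarrow> p k n \<in> D" "\<And>k. k < K \<Longrightarrow> p k \<longlonglongrightarrow> P k"
      by (auto dest!: bchoice)
    from f have "\<forall>k\<in>{..<K}. \<exists>f. (\<forall>n. f n \<in> E) \<and> f \<longlonglongrightarrow> alpha k"
      by (auto simp: feasible_def intro!: E(3))
    then obtain a where a: "\<And>k n. k < K \<Longrightarrow> a k n \<in> E" "\<And>k. k < K \<Longrightarrow> a k \<longlonglongrightarrow> alpha k"
      by (auto dest!: bchoice)
    from f have "\<forall>k\<in>{..<K}. \<exists>f. (\<forall>n. f n \<in> E) \<and> f \<longlonglongrightarrow> gamma k"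
      by (auto simp: feasible_def intro!: E(3))
    then obtain g where g: "\<And>k n. k < K \<Longrightarrow> g k n \<in> E" "\<And>k. k < K \<Longrightarrow> g k \<longlonglongrightarrow> gamma k"
      by (auto dest!: bchoice)
    have P: "\<And>j. j < K \<Longrightarrow> 0 \<le> P j" using f by (auto simp: feasible_def)
    have "(\<lambda>n. Rsum K Theta (\<lambda>k\<in>{..<K}. p k n) (\<lambda>k\<in>{..<K}. a k n) (\<lambda>k\<in>{..<K}. g k n))
        \<longlonglongrightarrow> Rsum K Theta P alpha gamma"
      unfolding Rsum_def
    \<comment> \<open>Continuity holds because every denominator is at least 1/2 and every argument
      of \<open>ln\<close> is at least 1.\<close>
    proof (intro tendsto_sum tendsto_ln tendsto_add tendsto_const tendsto_divide tendsto_mult)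
      fix k assume k: "k \<in> {..<K}"
      let ?I = "(\<Sum>j\<in>{..<K} - {k}. P j * beta Theta alpha gamma k j) + 1/2"
      have "0 < ?I" using interference_nonneg[of K P Theta alpha gamma k, OF P] by auto
      then show "?I \<noteq> 0" by simp
      have "0 \<le> P k * beta Theta alpha gamma k k / ?I"
        using k P \<open>0 < ?I\<close> by (intro divide_nonneg_nonneg mult_nonneg_nonneg beta_bounds) auto
      then show "1 + P k * beta Theta alpha gamma k k / ?I \<noteq> 0" by linarith
    qed (auto simp: beta_def intro!: tendsto_intros p a g)
    moreover have "Rsum K Theta (\<lambda>k\<in>{..<K}. p k n) (\<lambda>k\<in>{..<K}. a k n) (\<lambda>k\<in>{..<K}. g k n) \<le> c" for n
      using le p(1) a(1) g(1) unfolding Q_def by (auto simp: PiE_iff)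
    ultimately show ?thesis by (intro LIMSEQ_le_const2) auto
  qed
  have "{Theta \<in> space (phase_space K). max_Rsum K Theta \<le> c}
      = {Theta \<in> space (phase_space K). \<forall>t\<in>Q. case t of (P, alpha, gamma) \<Rightarrow> Rsum K Theta P alpha gamma \<le> c}"
    unfolding max_Rsum_le_iff using lim \<open>Q \<subseteq> feasible K\<close> by (intro Collect_cong conj_cong refl) blast
  also have "\<dots> \<in> sets (phase_space K)"
  proof (rule sets.sets_Collect_countable_All'[OF _ Q])
    fix t assume "t \<in> Q"
    have [measurable]: "(\<lambda>Theta. beta Theta alpha gamma k j) \<in> borel_measurable (phase_space K)"
      if "k \<in> {..<K}" "j \<in> {..<K}" for alpha gamma k j
      unfolding beta_def using that by simp
    have [measurable]: "(\<lambda>Theta. beta Theta alpha gamma k j) \<in> borel_measurable (phase_space K)"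
      if "k \<in> {..<K}" "j \<in> {..<K} - {k}" for alpha gamma k j
      using that by simp
    have [measurable]: "(\<lambda>Theta. Rsum K Theta P alpha gamma) \<in> borel_measurable (phase_space K)"
      for P alpha gamma
      unfolding Rsum_def by measurable
    show "{Theta \<in> space (phase_space K). case t of (P, alpha, gamma) \<Rightarrow> Rsum K Theta P alpha gamma \<le> c}
        \<in> sets (phase_space K)"
      by (cases t) simp
  qed
  finally show ?thesis .
qed

section \<open>Rounding the angles and counting weakly interfered users\<close>

lemma quantize_phase:
  obtains p :: int and m :: int and f :: real
  where "p \<in> {0..<64}" "0 \<le> f" "f < 1" "x = (p + f) * grid + m * pi"
proof
  \<comment> \<open>The cell number is split modulo 64: the remainder is the grid point, and the
    quotient counts periods because \<open>64 * grid = pi\<close>.\<close>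
  define n where "n = \<lfloor>x / grid\<rfloor>"
  have g: "grid > 0" "64 * grid = pi" by (simp_all add: grid_def)
  show "n mod 64 \<in> {0..<64}" by simp
  show "0 \<le> x / grid - n" "x / grid - n < 1" unfolding n_def by linarith+
  have "real_of_int n = of_int (n mod 64) + 64 * of_int (n div 64)"
    by (metis mod_mult_div_eq of_int_add of_int_mult of_int_numeral)
  then have "(of_int (n mod 64) + (x / grid - n)) * grid + of_int (n div 64) * (64 * grid) = x"
    using g(1) by (simp add: field_simps)
  then show "x = (of_int (n mod 64) + (x / grid - n)) * grid + of_int (n div 64) * pi"
    unfolding g(2) by simp
qed

lemma quantize_phases:
  fixes A :: "nat set"
  obtains p where "p \<in> A \<rightarrow>\<^sub>E {0..<64::int}"
    "\<And>k. k \<in> A \<Longrightarrow> \<exists>(m::int) f. 0 \<le> f \<and> f < 1 \<and> phi k = (p k + f) * grid + m * pi"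
proof -
  have "\<forall>k\<in>A. \<exists>p\<in>{0..<64::int}. \<exists>(m::int) f. 0 \<le> f \<and> f < 1 \<and> phi k = (p + f) * grid + m * pi"
    by (metis quantize_phase)
  then obtain p where "\<forall>k\<in>A. p k \<in> {0..<64::int} \<and> (\<exists>(m::int) f. 0 \<le> f \<and> f < 1 \<and> phi k = (p k + f) * grid + m * pi)"
    unfolding Bex_def by (auto dest!: bchoice)
  then show thesis by (intro that[of "restrict p A"]) auto
qed

text \<open>Rounding adds at most 1/16 to each term, so a weak user with average interference at
  most 1/16 stays below the 1/8 of \<open>aligned\<close>. More than \<open>R\<close> such users
  would then witness \<open>many_aligned\<close>.\<close>

lemma card_weak_interference_le:
  fixes Theta :: "nat \<times> nat \<Rightarrow> real" and alpha gamma :: "nat \<Rightarrow> real"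
    and R :: real
  assumes "A \<subseteq> {..<K}" "\<not> many_aligned R A Theta" "0 \<le> R"
  defines "B \<equiv> {k \<in> A. (\<Sum>j\<in>A - {k}. beta Theta alpha gamma k j) \<le> (real (card A) - 1) / 16}"
  shows "card B \<le> R"
proof (rule ccontr)
  assume "\<not> card B \<le> R"
  have fin: "finite A" "finite B" using assms(1) finite_subset[of A "{..<K}"] by (auto simp: B_def)
  obtain p where p: "p \<in> A \<rightarrow>\<^sub>E {0..<64::int}"
    "\<And>j. j \<in> A \<Longrightarrow> \<exists>(m::int) f. 0 \<le> f \<and> f < 1 \<and> alpha j - Theta (j, j) = (p j + f) * grid + m * pi"
    by (rule quantize_phases[of A "\<lambda>j. alpha j - Theta (j, j)"]) blast
  obtain q where q: "q \<in> A \<rightarrow>\<^sub>E {0..<64::int}"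
    "\<And>k. k \<in> A \<Longrightarrow> \<exists>(m::int) f. 0 \<le> f \<and> f < 1 \<and> gamma k = (q k + f) * grid + m * pi"
    by (rule quantize_phases[of A gamma]) blast
  have near: "(cos (p j * grid + Theta (k, j) - q k * grid))\<^sup>2 \<le> beta Theta alpha gamma k j + 1/16"
    if kj: "k \<in> A" "j \<in> A" for k j
  proof -
    let ?x = "p j * grid + Theta (k, j) - q k * grid"
    obtain m n :: int and f g :: real where fg: "0 \<le> f" "f < 1" "0 \<le> g" "g < 1"
      and m: "alpha j - Theta (j, j) = (p j + f) * grid + m * pi"
      and n: "gamma k = (q k + g) * grid + n * pi"
      using p(2)[OF kj(2)] q(2)[OF kj(1)] by blast
    have "alpha j + Theta (k, j) - Theta (j, j) - gamma k = (?x + (f - g) * grid) + of_int (m - n) * pi"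
      using m n by (simp add: algebra_simps)
    then have b: "beta Theta alpha gamma k j = (cos (?x + (f - g) * grid))\<^sup>2"
      unfolding beta_def by (metis cos_squared_plus_int_pi)
    \<comment> \<open>Both angles are rounded down and enter with opposite signs, so the total error
      stays within one cell instead of two.\<close>
    have "\<bar>(f - g) * grid\<bar> \<le> 1 * (1/16)"
      unfolding abs_mult using fg pi_less_4 by (intro mult_mono) (auto simp: grid_def)
    then show ?thesis
      using cos_squared_diff_le[of ?x "?x + (f - g) * grid"] unfolding b by linarith
  qed
  have "(\<Sum>j\<in>A - {k}. (cos (p j * grid + Theta (k, j) - q k * grid))\<^sup>2) \<le> (real (card A) - 1) / 8"
    if k: "k \<in> B" for k
  proof -
    have "k \<in> A" using k by (simp add: B_def)
    then have cA: "real (card (A - {k})) = real (card A) - 1"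
      using fin card_gt_0_iff[of A] by (auto simp: card_Diff_singleton of_nat_diff Suc_le_eq)
    have "(\<Sum>j\<in>A - {k}. (cos (p j * grid + Theta (k, j) - q k * grid))\<^sup>2)
        \<le> (\<Sum>j\<in>A - {k}. beta Theta alpha gamma k j + 1/16)"
      using \<open>k \<in> A\<close> by (intro sum_mono near) auto
    also have "\<dots> = (\<Sum>j\<in>A - {k}. beta Theta alpha gamma k j) + (real (card A) - 1) / 16"
      by (simp add: sum.distrib cA)
    also have "\<dots> \<le> (real (card A) - 1) / 8" using k unfolding B_def mem_Collect_eq by linarith
    finally show ?thesis .
  qed
  then have "(\<Sum>k\<in>B. \<Sum>j\<in>A - {k}. (cos (p j * grid + Theta (k, j) - q k * grid))\<^sup>2)
      \<le> (\<Sum>k\<in>B. (real (card A) - 1) / 8)" by (rule sum_mono)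
  then have "aligned A B p q Theta" by (simp add: aligned_def)
  moreover have "B \<subseteq> A" by (auto simp: B_def)
  ultimately show False
    using assms(2) p(1) q(1) \<open>\<not> card B \<le> R\<close> unfolding many_aligned_def by force
qed

section \<open>Sum-rate of one dyadic level and of all levels together\<close>

lemma sum_rate_level_le:
  fixes b :: real and P :: "nat \<Rightarrow> real"
  assumes P: "\<And>j. j < K \<Longrightarrow> 0 \<le> P j" and b: "0 < b" "b \<le> 1"
  defines "A \<equiv> {k. k < K \<and> b / 2 < P k \<and> P k \<le> b}"
  assumes "A \<noteq> {} \<Longrightarrow> \<not> many_aligned R A Theta" "0 \<le> R"
  shows "(\<Sum>k\<in>A. rate K Theta P alpha gamma k) \<le> 64 + 2 * R * b"
proof (cases "A = {}")
  case True
  show ?thesis using b \<open>0 \<le> R\<close> by (simp add: True)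
next
  case False
  let ?r = "rate K Theta P alpha gamma"
  have A: "A \<subseteq> {..<K}" "finite A" by (auto simp: A_def)
  define n where "n = real (card A)"
  have n: "1 \<le> n" unfolding n_def using A(2) False by (simp add: Suc_le_eq card_gt_0_iff)
  define B where "B = {k \<in> A. (\<Sum>j\<in>A - {k}. beta Theta alpha gamma k j) \<le> (n - 1) / 16}"
  have "B \<subseteq> A" by (auto simp: B_def)
  have cB: "card B \<le> R"
    unfolding B_def n_def
    by (rule card_weak_interference_le[OF A(1) assms(5)[OF False] assms(6)])
  have "(\<Sum>k\<in>B. ?r k) \<le> (\<Sum>k\<in>B. 2 * b)"
  proof (rule sum_mono)
    fix k assume "k \<in> B"
    then have "k < K" "P k \<le> b" by (auto simp: B_def A_def)
    then show "?r k \<le> 2 * b" using rate_le_twice_power[of K P k Theta alpha gamma, OF P] by simp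
  qed
  also have "\<dots> \<le> R * (2 * b)" using cB b by (simp add: mult_right_mono)
  finally have weak: "(\<Sum>k\<in>B. ?r k) \<le> 2 * R * b" by simp
  have "(\<Sum>k\<in>A - B. ?r k) \<le> (\<Sum>k\<in>A - B. 32 / n)"
  proof (rule sum_mono)
    fix k assume "k \<in> A - B"
    then have k: "k \<in> A" "k < K" "P k \<le> b" "(\<Sum>j\<in>A - {k}. beta Theta alpha gamma k j) > (n - 1) / 16"
      by (auto simp: B_def A_def)
    have "b / 2 * ((n - 1) / 16) \<le> b / 2 * (\<Sum>j\<in>A - {k}. beta Theta alpha gamma k j)"
      using b k(4) by (intro mult_left_mono) auto
    also have "\<dots> \<le> (\<Sum>j\<in>A - {k}. P j * beta Theta alpha gamma k j)"
      unfolding sum_distrib_left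
      by (intro sum_mono mult_right_mono beta_bounds) (auto simp: A_def)
    also have "\<dots> \<le> (\<Sum>j\<in>{..<K} - {k}. P j * beta Theta alpha gamma k j)"
      using A P by (intro sum_mono2 mult_nonneg_nonneg beta_bounds) auto
    \<comment> \<open>The noise 1/2 exceeds \<open>b / 32\<close> because \<open>b \<le> 1\<close>,
      which turns the factor \<open>n - 1\<close> into \<open>n\<close>.\<close>
    finally have "b * n / 32 \<le> (\<Sum>j\<in>{..<K} - {k}. P j * beta Theta alpha gamma k j) + 1/2"
      using b by (simp add: field_simps)
    then have "?r k \<le> P k / (b * n / 32)"
      using b n k P by (intro rate_le_divide) auto
    also have "\<dots> \<le> b / (b * n / 32)"
      using b n k by (intro divide_right_mono) auto
    also have "\<dots> = 32 / n" using b by simp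
    finally show "?r k \<le> 32 / n" .
  qed
  also have "\<dots> \<le> n * (32 / n)"
    using card_mono[OF A(2), of "A - B"] n by (simp add: n_def field_simps)
  also have "\<dots> = 32" using n by simp
  finally have "(\<Sum>k\<in>A - B. ?r k) \<le> 32" .
  with weak show ?thesis
    using sum.subset_diff[OF \<open>B \<subseteq> A\<close> A(2), of ?r] by simp
qed

lemma dyadic_level:
  fixes x :: real
  assumes "(1/2) ^ L < x" "x \<le> 1"
  shows "\<exists>l<L. (1/2) ^ l / 2 < x \<and> x \<le> (1/2) ^ l"
  using assms
proof (induction L)
  case (Suc L)
  show ?case
  proof (cases "(1/2) ^ L < x")
    case True
    with Suc obtain l where "l < L" "(1/2) ^ l / 2 < x \<and> x \<le> (1/2) ^ l" by blast
    then show ?thesis using less_SucI by blast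
  next
    case False
    with Suc.prems show ?thesis by (intro exI[of _ L]) auto
  qed
qed simp

lemma Rsum_le_of_not_many_aligned:
  assumes "(P, alpha, gamma) \<in> feasible K" "0 \<le> R" "real K \<le> 2 ^ L"
    and "\<And>A. A \<subseteq> {..<K} \<Longrightarrow> A \<noteq> {} \<Longrightarrow> \<not> many_aligned R A Theta"
  shows "Rsum K Theta P alpha gamma \<le> 2 + 64 * real L + 4 * R"
proof -
  let ?r = "rate K Theta P alpha gamma"
  have P: "\<And>j. j < K \<Longrightarrow> 0 \<le> P j" "\<And>j. j < K \<Longrightarrow> P j \<le> 1"
    using assms(1) by (auto simp: feasible_def)
  have r0: "0 \<le> ?r k" if "k < K" for k
    unfolding rate_def using that interference_nonneg[of K P Theta alpha gamma k, OF P(1)] P(1)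
    by (intro ln_ge_zero) (auto intro!: divide_nonneg_nonneg mult_nonneg_nonneg beta_bounds)
  \<comment> \<open>Powers in \<open>T\<close> are at most \<open>1 / K\<close> because
    \<open>K \<le> 2 ^ L\<close>, so these users together contribute at most 2.\<close>
  define T where "T = {k. k < K \<and> P k \<le> (1/2) ^ L}"
  define A where "A l = {k. k < K \<and> (1/2) ^ l / 2 < P k \<and> P k \<le> (1/2) ^ l}" for l :: nat
  have fin: "finite T" "finite (A l)" for l by (auto simp: T_def A_def)
  have "?r k \<le> (if k \<in> T then ?r k else 0) + (\<Sum>l<L. if k \<in> A l then ?r k else 0)" if k: "k < K" for k
  proof (cases "k \<in> T")
    case True
    have "0 \<le> (\<Sum>l<L. if k \<in> A l then ?r k else 0)" using r0[OF k] by (intro sum_nonneg) auto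
    with True show ?thesis by simp
  next
    case False
    then obtain l where l: "l < L" "k \<in> A l"
      using k dyadic_level[of L "P k"] P(2)[of k] by (auto simp: T_def A_def not_le)
    then have "(if k \<in> A l then ?r k else 0) \<le> (\<Sum>l<L. if k \<in> A l then ?r k else 0)"
      using r0[OF k] by (intro member_le_sum) auto
    with l False show ?thesis by simp
  qed
  then have "Rsum K Theta P alpha gamma
      \<le> (\<Sum>k<K. (if k \<in> T then ?r k else 0) + (\<Sum>l<L. if k \<in> A l then ?r k else 0))"
    unfolding Rsum_eq_sum_rate by (intro sum_mono) auto
  also have "\<dots> = (\<Sum>k<K. if k \<in> T then ?r k else 0) + (\<Sum>l<L. \<Sum>k<K. if k \<in> A l then ?r k else 0)"
    unfolding sum.distrib by (subst sum.swap) simp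
  also have "\<dots> = (\<Sum>k\<in>T. ?r k) + (\<Sum>l<L. \<Sum>k\<in>A l. ?r k)"
  proof -
    have "T \<subseteq> {..<K}" "A l \<subseteq> {..<K}" for l by (auto simp: T_def A_def)
    then show ?thesis by (simp add: sum.If_cases Int_absorb1)
  qed
  \<comment> \<open>Only the constant 64 is paid once per level. The weak users carry the weight
    \<open>(1/2) ^ l\<close>, so \<open>R\<close> enters through a geometric sum; a factor
    \<open>L * R\<close> would be of order (ln K)^2.\<close>
  also have "(\<Sum>l<L. \<Sum>k\<in>A l. ?r k) \<le> (\<Sum>l<L. 64 + 2 * R * (1/2) ^ l)"
    unfolding A_def using assms(2) P(1) 
    by (intro sum_mono sum_rate_level_le assms(4)) (auto simp: power_le_one)
  also have "\<dots> = 64 * real L + 2 * R * (\<Sum>l<L. (1/2) ^ l)"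
    by (simp add: sum.distrib sum_distrib_left)
  also have "(\<Sum>l<L. (1/2) ^ l) \<le> (2 :: real)"
    by (simp add: sum_gp_strict)
  also have "(\<Sum>k\<in>T. ?r k) \<le> (\<Sum>k\<in>T. 2 * (1/2) ^ L)"
  proof (rule sum_mono)
    fix k assume "k \<in> T"
    then show "?r k \<le> 2 * (1/2) ^ L"
      using rate_le_twice_power[of K P k Theta alpha gamma, OF P(1)] by (auto simp: T_def)
  qed
  also have "\<dots> \<le> 2 * (real K * (1/2) ^ L)"
    using card_mono[of "{..<K}" T] by (auto simp: T_def)
  also have "real K * (1/2) ^ L \<le> 1"
    using assms(3) by (simp add: power_one_over field_simps)
  finally show ?thesis using assms(2) by (simp add: mult_left_mono)
qed

section \<open>Choice of the constant and passage to the limit\<close>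

theorem theorem2:
  shows "\<exists>C>0. (\<lambda>K. measure (phase_space K)
            {Theta \<in> space (phase_space K). max_Rsum K Theta \<le> C * ln (real K)})
          \<longlonglongrightarrow> 1"
proof (intro exI conjI)
  \<comment> \<open>With \<open>L \<le> 2 * ln K + 1\<close> and \<open>R = 32 * ln K\<close>, the
    bound \<open>2 + 64 * L + 4 * R\<close> is at most \<open>66 + 256 * ln K\<close>, and
    \<open>ln K \<ge> 1\<close> absorbs the 66.\<close>
  define C :: real where "C = 322"
  show "C > 0" by (simp add: C_def)
  define G where "G K = {Theta \<in> space (phase_space K). max_Rsum K Theta \<le> C * ln (real K)}" for K
  \<comment> \<open>The condition \<open>3 \<le> K\<close> ensures \<open>exp 1 \<le> K\<close>,
    hence \<open>ln K \<ge> 1\<close>.\<close>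
  have lower: "2 - exp (8192 / real K) \<le> measure (phase_space K) (G K)" if K: "3 \<le> K" for K
  proof -
    interpret prob_space "phase_space K" by (rule prob_space_phase_space)
    define R where "R = 32 * ln (real K)"
    define E where "E = {Theta \<in> space (phase_space K). \<exists>A\<in>Pow {..<K} - {{}}. many_aligned R A Theta}"
    have E: "E \<in> sets (phase_space K)"
      unfolding E_def by (intro sets.sets_Collect_finite_Ex measurable_many_aligned) auto
    define L where "L = nat \<lceil>log 2 (real K)\<rceil>"
    have "exp 1 \<le> real K" using exp_le K by linarith
    then have ln1: "1 \<le> ln (real K)" using K by (simp add: ln_ge_iff)
    have "1 / 2 \<le> ln (2 :: real)"
      using ln_add_one_self_le_self2[of "-1/2::real"] by (simp add: ln_div)
    then have "ln (real K) / ln 2 \<le> ln (real K) / (1/2)"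
      using ln1 by (intro divide_left_mono) auto
    then have log: "log 2 (real K) \<le> 2 * ln (real K)" by (simp add: log_def)
    have "0 \<le> log 2 (real K)" using K by simp
    then have L: "log 2 (real K) \<le> real L" "real L \<le> log 2 (real K) + 1"
      unfolding L_def by linarith+
    have "real K = 2 powr log 2 (real K)" using K by simp
    also have "\<dots> \<le> 2 powr real L" using L by simp
    finally have KL: "real K \<le> 2 ^ L" by (simp add: powr_realpow)
    have "2 + 64 * real L + 4 * R \<le> C * ln (real K)"
      using L(2) log ln1 unfolding R_def C_def by linarith
    moreover have R: "0 \<le> R" using ln1 by (simp add: R_def)
    have "max_Rsum K Theta \<le> 2 + 64 * real L + 4 * R"
      if "Theta \<in> space (phase_space K) - E" for Theta
      unfolding max_Rsum_le_iff using that R KL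
      by (auto simp: E_def intro!: Rsum_le_of_not_many_aligned)
    ultimately have "space (phase_space K) - E \<subseteq> G K"
      unfolding G_def by fastforce
    then have "prob (space (phase_space K) - E) \<le> prob (G K)"
      unfolding G_def by (intro finite_measure_mono measurable_max_Rsum_le)
    moreover have "prob (space (phase_space K) - E) = 1 - prob E"
      by (rule prob_compl[OF E])
    moreover have "prob E \<le> exp (8192 / real K) - 1"
      unfolding E_def R_def using K by (intro prob_ex_many_aligned_le) auto
    ultimately show ?thesis by linarith
  qed
  have "(\<lambda>K. measure (phase_space K) (G K)) \<longlonglongrightarrow> 1"
  proof (rule tendsto_sandwich)
    show "\<forall>\<^sub>F K in sequentially. 2 - exp (8192 / real K) \<le> measure (phase_space K) (G K)"
      using lower by (intro eventually_sequentiallyI[of 3])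
    show "\<forall>\<^sub>F K in sequentially. measure (phase_space K) (G K) \<le> 1"
      using prob_space.prob_le_1[OF prob_space_phase_space] by auto
    have "(\<lambda>K. 2 - exp (8192 / real K)) \<longlonglongrightarrow> 2 - exp 0"
      by (intro tendsto_intros lim_const_over_n)
    then show "(\<lambda>K. 2 - exp (8192 / real K)) \<longlonglongrightarrow> 1" by simp
  qed auto
  then show "(\<lambda>K. measure (phase_space K)
      {Theta \<in> space (phase_space K). max_Rsum K Theta \<le> C * ln (real K)}) \<longlonglongrightarrow> 1"
    by (simp add: G_def)
qed

end
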